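(* Let $\Omega\subseteq\mathbb{R}^N$ be a Lebesgue measurable set of finite Lebesgue measure such that there exist $\alpha>0$, $\mathcal M\in(0,+\infty)$ and $D<-N$ satisfying $$|{}_t\Omega|=t^{N+D}\bigl(\mathcal M+O(t^{-\alpha})\bigr)\quad\text{as }t\to+\infty.$$ Then $\dim_B(\infty,\Omega)$ exists and $\dim_B(\infty,\Omega)=D$. Furthermore, $\Omega$ is Minkowski measurable at infinity with Minkowski content $\mathcal M^D(\infty,\Omega)=\mathcal M$. Moreover, the tube zeta function $\widetilde\zeta_{\infty,\Omega}$ has abscissa of convergence $D(\widetilde\zeta_{\infty,\Omega})=\dim_B(\infty,\Omega)=D$ and possesses a unique meromorphic continuation (still denoted by $\widetilde\zeta_{\infty,\Omega}$) to (at least) the open half-plane $\{\operatorname{Re}s>D-\alpha\}$. The only pole of $\widetilde\zeta_{\infty,\Omega}$ in this half-plane is $s=D$; it is simple, and $$\operatorname{res}(\widetilde\zeta_{\infty,\Omega},D)=\mathcal M.$$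
   Context: $|\cdot|$ denotes $N$-dimensional Lebesgue measure. For $t>0$, ${}_t\Omega:=B_t(0)^c\cap\Omega$, where $B_t(0)$ is the open Euclidean ball of radius $t$ centered at $0$. For $r\in\mathbb{R}$, the upper and lower $r$-dimensional Minkowski contents of $\Omega$ at infinity, $\overline{\mathcal M}^r(\infty,\Omega)$ and $\underline{\mathcal M}^r(\infty,\Omega)$, are the $\limsup$ and $\liminf$ of $|{}_t\Omega|/t^{N+r}$ as $t\to+\infty$; if they coincide the common value is $\mathcal M^r(\infty,\Omega)$. The upper (lower) Minkowski dimension at infinity is the infimum of all $r\in\mathbb{R}$ for which the upper (lower) $r$-dimensional content is $0$; if both coincide the common value is $\dim_B(\infty,\Omega)$. $\Omega$ is Minkowski measurable at infinity if for $D=\dim_B(\infty,\Omega)$ one has $0<\underline{\mathcal M}^D(\infty,\Omega)=\overline{\mathcal M}^D(\infty,\Omega)<\infty$. The tube zeta function at infinity is $\widetilde\zeta_{\infty,\Omega}(s):=\int_T^{+\infty}t^{-s-N-1}|{}_t\Omega|\,dt$ for a fixed $T>0$ (changing $T$ only adds an entire function). Its abscissa of convergence $D(\widetilde\zeta_{\infty,\Omega})$ is the infimum of all $\sigma\in\mathbb{R}$ such that this integral converges absolutely for all $s$ with $\operatorname{Re}s>\sigma$. $\operatorname{res}(f,\omega)$ is the residue of $f$ at $\omega$. *)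

theory Defs
  imports "HOL-Complex_Analysis.Complex_Analysis" "HOL-Library.Landau_Symbols"
begin

definition outer_part :: "real \<Rightarrow> (real ^ 'n) set \<Rightarrow> (real ^ 'n) set" where
  "outer_part t \<Omega> = - ball 0 t \<inter> \<Omega>"

definition upper_content_inf :: "real \<Rightarrow> (real ^ 'n) set \<Rightarrow> ennreal" where
  "upper_content_inf r \<Omega> = Limsup at_top (\<lambda>t::real.
     emeasure lebesgue (outer_part t \<Omega>) / ennreal (t powr (real CARD('n) + r)))"

definition lower_content_inf :: "real \<Rightarrow> (real ^ 'n) set \<Rightarrow> ennreal" where
  "lower_content_inf r \<Omega> = Liminf at_top (\<lambda>t::real.
     emeasure lebesgue (outer_part t \<Omega>) / ennreal (t powr (real CARD('n) + r)))"

(* Unspecified unless the lower and upper contents coincide. *)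
definition content_inf :: "real \<Rightarrow> (real ^ 'n) set \<Rightarrow> ennreal" where
  "content_inf r \<Omega> = (THE c. lower_content_inf r \<Omega> = c \<and> upper_content_inf r \<Omega> = c)"

(* The infima run over real exponents but are taken in the extended reals:
   a set of exponents unbounded below has infimum -infinity and the empty one +infinity. *)
definition upper_dim_inf :: "(real ^ 'n) set \<Rightarrow> ereal" where
  "upper_dim_inf \<Omega> = Inf (ereal ` {r. upper_content_inf r \<Omega> = 0})"

definition lower_dim_inf :: "(real ^ 'n) set \<Rightarrow> ereal" where
  "lower_dim_inf \<Omega> = Inf (ereal ` {r. lower_content_inf r \<Omega> = 0})"

definition dim_inf_exists :: "(real ^ 'n) set \<Rightarrow> bool" where
  "dim_inf_exists \<Omega> \<longleftrightarrow> lower_dim_inf \<Omega> = upper_dim_inf \<Omega>"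

(* Unspecified unless the lower and upper dimensions coincide. *)
definition dim_inf :: "(real ^ 'n) set \<Rightarrow> ereal" where
  "dim_inf \<Omega> = (THE d. lower_dim_inf \<Omega> = d \<and> upper_dim_inf \<Omega> = d)"

definition minkowski_measurable_inf :: "(real ^ 'n) set \<Rightarrow> bool" where
  "minkowski_measurable_inf \<Omega> \<longleftrightarrow> dim_inf_exists \<Omega> \<and>
     (\<exists>D::real. dim_inf \<Omega> = ereal D \<and>
        0 < lower_content_inf D \<Omega> \<and>
        lower_content_inf D \<Omega> = upper_content_inf D \<Omega> \<and>
        upper_content_inf D \<Omega> < \<infinity>)"

(* The real-valued measure is the intended one only when \<Omega> has finite measure. *)
definition tube_zeta_integrand :: "(real ^ 'n) set \<Rightarrow> complex \<Rightarrow> real \<Rightarrow> complex" where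
  "tube_zeta_integrand \<Omega> s t =
     complex_of_real t powr (- s - of_nat CARD('n) - 1) *
     complex_of_real (measure lebesgue (outer_part t \<Omega>))"

definition tube_zeta_inf :: "real \<Rightarrow> (real ^ 'n) set \<Rightarrow> complex \<Rightarrow> complex" where
  "tube_zeta_inf T \<Omega> s = (LINT t:{T..}|lborel. tube_zeta_integrand \<Omega> s t)"

(* Integrability in the Bochner sense is absolute convergence of the integral. *)
definition tube_zeta_abscissa :: "real \<Rightarrow> (real ^ 'n) set \<Rightarrow> ereal" where
  "tube_zeta_abscissa T \<Omega> = Inf (ereal ` {\<sigma>. \<forall>s. Re s > \<sigma> \<longrightarrow>
     set_integrable lborel {T..} (tube_zeta_integrand \<Omega> s)})"

(* HOL functions are total, so a meromorphic function may take arbitrary values on a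
   discrete set; nicely_meromorphic_on fixes them by removing removable singularities
   and putting the value 0 at poles.  Values outside A are irrelevant. *)
definition tube_zeta_continuation ::
    "real \<Rightarrow> (real ^ 'n) set \<Rightarrow> complex set \<Rightarrow> (complex \<Rightarrow> complex) \<Rightarrow> bool" where
  "tube_zeta_continuation T \<Omega> A Z \<longleftrightarrow>
     {s. tube_zeta_abscissa T \<Omega> < ereal (Re s)} \<subseteq> A \<and>
     Z nicely_meromorphic_on A \<and>
     (\<forall>s. tube_zeta_abscissa T \<Omega> < ereal (Re s) \<longrightarrow> Z s = tube_zeta_inf T \<Omega> s)"

end

theory Submission
  imports Defs
begin

text \<open>
  Write \<open>V t\<close> for the measure of the part of \<open>\<Omega>\<close> outside the ball of radius \<open>t\<close>, \<open>N\<close> for the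
  dimension, and \<open>W t = V t / t powr (N + D) - M\<close>, so that \<open>W t = O(t powr (- \<alpha>))\<close> at infinity.
  On the ray from \<open>T\<close> the function \<open>W\<close> is bounded on every compact piece, because \<open>V\<close> is monotone
  and \<open>t powr (- N - D)\<close> is increasing; so the decay is a bound
  \<open>\<bar>W t\<bar> \<le> C * t powr (- \<alpha>)\<close> on the whole ray, not just eventually (\<open>powr_bound_on_ray\<close>).

  The contents are read off from \<open>V t / t powr (N + r) = (M + W t) * t powr (D - r)\<close>: the limit is
  infinite, \<open>M\<close> or \<open>0\<close> according as \<open>r\<close> lies below, at or above \<open>D\<close> (\<open>content_inf_of_power_law\<close>).
  This settles the dimension and the Minkowski measurability.

  For the tube zeta function, the integrand is \<open>t powr (- (s - D) - 1) * (M + W t)\<close>.  The constant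
  \<open>M\<close> contributes an elementary integral with value \<open>M * T powr (- (s - D)) / (s - D)\<close>, valid for
  \<open>Re s > D\<close>; the remainder \<open>W\<close> contributes \<open>G (s - D)\<close>, where \<open>G\<close> is given by an integral that
  still converges, and is holomorphic, for \<open>Re s > D - \<alpha>\<close>
  (\<open>tube_zeta_of_power_law\<close>, \<open>holomorphic_on_LINT_cpowr_times\<close>).
  Putting both terms over the denominator \<open>s - D\<close> displays the continuation as a holomorphic function
  divided by \<open>s - D\<close>, with numerator \<open>M \<noteq> 0\<close> at \<open>D\<close>: a simple pole with residue \<open>M\<close>
  (\<open>simple_pole_quotient\<close>).  At \<open>s = D\<close> itself the remainder is integrable and \<open>M / t\<close> is not, so the
  abscissa of convergence is exactly \<open>D\<close>.  Uniqueness of the continuation is the identity theorem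
  (\<open>nicely_meromorphic_on_eqI\<close>).
\<close>

section \<open>Holomorphic parameter integrals and meromorphic functions\<close>

text \<open>
  Cauchy's estimate turns domination of the integrand into domination of its derivative: a bound
  \<open>g\<close> on a ball of radius \<open>r\<close> yields the bound \<open>2 * g / r\<close> for the derivative on
  the concentric ball of half the radius, hence for the difference quotients, and dominated convergence
  applies to these.
\<close>
lemma holomorphic_on_lebesgue_integral:
  fixes f :: "complex \<Rightarrow> 'a \<Rightarrow> complex"
  assumes "open S"
    and hol: "\<And>x. x \<in> space \<mu> \<Longrightarrow> (\<lambda>z. f z x) holomorphic_on S"
    and meas: "\<And>z. z \<in> S \<Longrightarrow> f z \<in> borel_measurable \<mu>"
    and dom: "\<And>z\<^sub>0. z\<^sub>0 \<in> S \<Longrightarrow> \<exists>r>0. \<exists>g. ball z\<^sub>0 r \<subseteq> S \<and> integrable \<mu> g \<and>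
                (\<forall>z\<in>ball z\<^sub>0 r. \<forall>x\<in>space \<mu>. norm (f z x) \<le> g x)"
  shows "(\<lambda>z. \<integral>x. f z x \<partial>\<mu>) holomorphic_on S"
proof -
  have "\<exists>D. ((\<lambda>z. \<integral>x. f z x \<partial>\<mu>) has_field_derivative D) (at z\<^sub>0)" if z0: "z\<^sub>0 \<in> S" for z\<^sub>0
  proof -
    obtain r g where "r > 0" and sub: "ball z\<^sub>0 r \<subseteq> S" and g: "integrable \<mu> g"
      and bnd: "\<And>z x. z \<in> ball z\<^sub>0 r \<Longrightarrow> x \<in> space \<mu> \<Longrightarrow> norm (f z x) \<le> g x"
      using dom[OF z0] by blast
    define q where "q h x = (f (z\<^sub>0 + h) x - f z\<^sub>0 x) / h" for h x
    have int: "integrable \<mu> (f z)" if "z \<in> ball z\<^sub>0 r" for z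
    proof (rule Bochner_Integration.integrable_bound[OF g])
      show "AE x in \<mu>. norm (f z x) \<le> norm (g x)"
        using bnd[OF that] by (intro AE_I2) (auto intro: order_trans[OF _ abs_ge_self])
    qed (use that sub meas in auto)
    have qbnd: "norm (q h x) \<le> 2 * g x / r"
      if h: "h \<noteq> 0" "norm h < r / 2" and x: "x \<in> space \<mu>" for h x
    proof -
      have d: "norm (deriv (\<lambda>z. f z x) w) \<le> 2 * g x / r" if w: "w \<in> ball z\<^sub>0 (r/2)" for w
      proof -
        have wr: "cball w (r/2) \<subseteq> ball z\<^sub>0 r"
        proof
          fix y assume "y \<in> cball w (r/2)"
          thus "y \<in> ball z\<^sub>0 r" using w dist_triangle[of z\<^sub>0 y w] by auto
        qed
        have "norm ((deriv ^^ 1) (\<lambda>z. f z x) w) \<le> fact 1 * g x / (r/2) ^ 1"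
        proof (rule Cauchy_inequality)
          show "(\<lambda>z. f z x) holomorphic_on ball w (r/2)"
            using wr sub by (intro holomorphic_on_subset[OF hol[OF x]]) force
          show "continuous_on (cball w (r/2)) (\<lambda>z. f z x)"
            using wr sub by (intro holomorphic_on_imp_continuous_on holomorphic_on_subset[OF hol[OF x]]) force
          show "norm (f y x) \<le> g x" if "norm (w - y) = r / 2" for y
            using that wr by (intro bnd x) (auto simp: dist_norm subset_iff)
        qed (use \<open>r > 0\<close> in auto)
        thus ?thesis by (simp add: mult.commute)
      qed
      have "norm (f (z\<^sub>0 + h) x - f z\<^sub>0 x) \<le> 2 * g x / r * norm (z\<^sub>0 + h - z\<^sub>0)"
      proof (rule field_differentiable_bound[where S = "ball z\<^sub>0 (r/2)" and f = "\<lambda>z. f z x"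
              and f' = "deriv (\<lambda>z. f z x)"])
        fix w assume w: "w \<in> ball z\<^sub>0 (r/2)"
        hence "w \<in> S" using sub \<open>r > 0\<close> by (auto simp: subset_iff)
        thus "((\<lambda>z. f z x) has_field_derivative deriv (\<lambda>z. f z x) w) (at w within ball z\<^sub>0 (r/2))"
          by (rule holomorphic_derivI[OF hol[OF x] \<open>open S\<close>])
      qed (use h d \<open>r > 0\<close> in \<open>auto simp: dist_norm\<close>)
      thus ?thesis using h by (simp add: q_def norm_divide field_simps)
    qed
    define D where "D = (\<integral>x. deriv (\<lambda>z. f z x) z\<^sub>0 \<partial>\<mu>)"
    have "((\<lambda>h. ((\<integral>x. f (z\<^sub>0 + h) x \<partial>\<mu>) - (\<integral>x. f z\<^sub>0 x \<partial>\<mu>)) / h) \<longlongrightarrow> D) (at 0)"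
      unfolding tendsto_at_iff_sequentially
    proof (intro allI impI)
      fix X :: "nat \<Rightarrow> complex"
      assume X: "\<forall>i. X i \<in> UNIV - {0}" "X \<longlonglongrightarrow> 0"
      have "\<forall>\<^sub>F n in sequentially. norm (X n) < r / 2"
        using X(2) \<open>r > 0\<close> by (intro order_tendstoD[OF tendsto_norm_zero]) auto
      then obtain m where m: "\<And>n. n \<ge> m \<Longrightarrow> norm (X n) < r / 2"
        by (auto simp: eventually_sequentially)
      \<comment> \<open>The domination holds only for small increments, so the sequence is used from index \<open>m\<close> on.\<close>
      have XS: "z\<^sub>0 + X (n + m) \<in> ball z\<^sub>0 r" for n
        using m[of "n + m"] \<open>r > 0\<close> by (auto simp: dist_norm)
      have qm: "q (X (n + m)) \<in> borel_measurable \<mu>" for n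
        unfolding q_def using meas[OF subsetD[OF sub XS]] meas[OF z0]
        by (intro borel_measurable_divide borel_measurable_diff) auto
      have lim: "(\<lambda>n. q (X (n + m)) x) \<longlonglongrightarrow> deriv (\<lambda>z. f z x) z\<^sub>0" if "x \<in> space \<mu>" for x
      proof -
        have "((\<lambda>h. q h x) \<longlongrightarrow> deriv (\<lambda>z. f z x) z\<^sub>0) (at 0)"
          using holomorphic_derivI[OF hol[OF that] \<open>open S\<close> z0, of UNIV]
          by (simp add: DERIV_def q_def)
        hence "(\<lambda>n. q (X n) x) \<longlonglongrightarrow> deriv (\<lambda>z. f z x) z\<^sub>0"
          using X by (auto simp: tendsto_at_iff_sequentially o_def)
        thus ?thesis by (rule LIMSEQ_ignore_initial_segment)
      qed
      have "(\<lambda>n. \<integral>x. q (X (n + m)) x \<partial>\<mu>) \<longlonglongrightarrow> D"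
        unfolding D_def
      proof (rule integral_dominated_convergence[where w = "\<lambda>x. 2 * g x / r"])
        show "AE x in \<mu>. norm (q (X (n + m)) x) \<le> 2 * g x / r" for n
          using X(1) m[of "n + m"] by (intro AE_I2 qbnd) auto
        show "(\<lambda>x. deriv (\<lambda>z. f z x) z\<^sub>0) \<in> borel_measurable \<mu>"
          by (rule borel_measurable_LIMSEQ_metric[OF qm lim])
      qed (use g lim qm in auto)
      also have "(\<lambda>n. \<integral>x. q (X (n + m)) x \<partial>\<mu>) =
          (\<lambda>n. ((\<integral>x. f (z\<^sub>0 + X (n + m)) x \<partial>\<mu>) - (\<integral>x. f z\<^sub>0 x \<partial>\<mu>)) / X (n + m))"
        unfolding q_def using int XS \<open>r > 0\<close> by (simp add: Bochner_Integration.integral_diff)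
      finally show "((\<lambda>h. ((\<integral>x. f (z\<^sub>0 + h) x \<partial>\<mu>) - (\<integral>x. f z\<^sub>0 x \<partial>\<mu>)) / h) \<circ> X) \<longlonglongrightarrow> D"
        unfolding o_def by (rule LIMSEQ_offset)
    qed
    thus ?thesis by (auto simp: DERIV_def)
  qed
  thus ?thesis using \<open>open S\<close> by (simp add: holomorphic_on_open)
qed

text \<open>
  The identity theorem.  The difference is only meromorphic, not nicely so: where both functions have
  a pole it may have a removable singularity.  Once its singularities are removed it vanishes on \<open>A\<close>.
  This gives equality near, but not at, each point; there the convention for values at poles decides.
\<close>
lemma nicely_meromorphic_on_eqI:
  assumes f: "f nicely_meromorphic_on A" and g: "g nicely_meromorphic_on A"
    and A: "open A" "connected A" "z \<in> A"
    and freq: "\<exists>\<^sub>F w in at z. f w = g w" and w: "w \<in> A"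
  shows "f w = g w"
proof -
  have mf: "f meromorphic_on A" and mg: "g meromorphic_on A"
    using f g by (auto simp: nicely_meromorphic_on_def)
  define h where "h = remove_sings (\<lambda>z. f z - g z)"
  have md: "(\<lambda>z. f z - g z) meromorphic_on A"
    using mf mg by (intro meromorphic_intros)
  have ev: "\<forall>\<^sub>F y in at x. h y = f y - g y" if "x \<in> A" for x
    unfolding h_def using md that
    by (metis eventually_remove_sings_eq_at meromorphic_onE)
  have h0: "h x = 0" if "x \<in> A" for x
  proof (rule frequently_eq_meromorphic_imp_constant[of h 0 z A])
    show "\<exists>\<^sub>F w in at z. h w = 0"
      using frequently_eventually_frequently[OF freq ev[OF \<open>z \<in> A\<close>]]
      by (rule frequently_elim1) auto
    show "h nicely_meromorphic_on A"
      unfolding h_def by (rule remove_sings_nicely_meromorphic[OF md])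
  qed (use A that in auto)
  \<comment> \<open>\<open>h\<close> agrees with the difference only off \<open>w\<close>, which determines poles and limits at \<open>w\<close>.\<close>
  have fg: "\<forall>\<^sub>F y in at w. f y = g y"
    using ev[OF w] eventually_at_in_open'[OF \<open>open A\<close> w]
    by eventually_elim (use h0 in auto)
  have "is_pole f w \<longleftrightarrow> is_pole g w"
    using fg by (intro is_pole_cong) auto
  moreover have lim: "f \<midarrow>w\<rightarrow> c \<longleftrightarrow> g \<midarrow>w\<rightarrow> c" for c
    using fg by (rule tendsto_cong)
  moreover have "\<not> (is_pole g w \<and> g \<midarrow>w\<rightarrow> c)" for c
    using not_tendsto_and_filterlim_at_infinity[of "at w" g c] by (auto simp: is_pole_def)
  ultimately consider "f w = 0" "g w = 0" | "g \<midarrow>w\<rightarrow> f w" "g \<midarrow>w\<rightarrow> g w"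
    using f g w unfolding nicely_meromorphic_on_def by blast
  thus ?thesis by cases (auto dest: LIM_unique)
qed

text \<open>
  The value at \<open>p\<close> is \<open>H p / 0 = 0\<close>, which is just the value that a nicely meromorphic function must
  take at a pole.
\<close>
lemma simple_pole_quotient:
  assumes A: "open A" "p \<in> A" and H: "H holomorphic_on A" and "H p \<noteq> 0"
  defines "Z \<equiv> \<lambda>s. H s / (s - p)"
  shows "Z nicely_meromorphic_on A"
    and "\<And>s. s \<in> A \<Longrightarrow> is_pole Z s \<longleftrightarrow> s = p"
    and "zorder Z p = -1"
    and "residue Z p = H p"
proof -
  have pole: "is_pole Z p"
    unfolding Z_def
  proof (rule is_pole_divide)
    show "isCont H p"
      using A H by (meson continuous_on_eq_continuous_at holomorphic_on_imp_continuous_on)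
    show "filterlim (\<lambda>s. s - p) (at 0) (at p)"
      by (auto simp: filterlim_at eventually_at_filter intro!: tendsto_eq_intros)
  qed fact
  have hol: "Z holomorphic_on A - {p}"
    unfolding Z_def by (intro holomorphic_intros holomorphic_on_subset[OF H]) auto
  have ana: "Z analytic_on A - {p}"
    using hol A by (subst analytic_on_open) auto
  show "is_pole Z s \<longleftrightarrow> s = p" if "s \<in> A" for s
    using that pole hol A not_is_pole_holomorphic[of "A - {p}" s Z] by auto
  show "Z nicely_meromorphic_on A"
  proof (rule nicely_meromorphic_onI_open[OF A(1) ana])
    show "isolated_singularity_at Z s" if "s \<in> A" for s
    proof (cases "s = p")
      case True
      thus ?thesis using isolated_singularity_at_holomorphic[OF hol A] by simp
    next
      case False
      thus ?thesis using that ana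
        by (intro isolated_singularity_at_analytic) (auto intro: analytic_on_subset)
    qed
  qed (use pole in \<open>auto simp: Z_def\<close>)
  show "zorder Z p = -1"
    using zorder_nonzero_div_power[OF A H \<open>H p \<noteq> 0\<close>, of 1] by (simp add: Z_def)
  show "residue Z p = H p"
    unfolding Z_def by (rule residue_simple[OF A H])
qed

section \<open>Integrals of powers over a ray\<close>

lemma set_integrable_powr_to_inf:
  fixes e T :: real
  assumes "e < -1" "T > 0"
  shows "set_integrable lborel {T..} (\<lambda>t. t powr e)"
proof -
  have "(\<lambda>t. t powr e) absolutely_integrable_on {T..}"
    using has_integral_powr_to_inf[OF assms]
    by (intro nonnegative_absolutely_integrable_1) (auto simp: integrable_on_def)
  moreover have "(\<lambda>t. indicator {T..} t *\<^sub>R t powr e) \<in> borel_measurable lborel"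
    by measurable
  ultimately show ?thesis
    unfolding set_integrable_def by (simp only: integrable_completion)
qed

lemma norm_cpowr_of_real:
  assumes "t > 0"
  shows "norm (complex_of_real t powr w) = t powr Re w"
  using assms by (simp add: norm_powr_real_powr)

lemma borel_measurable_cpowr [measurable]:
  "(\<lambda>t::real. complex_of_real t powr w) \<in> borel_measurable borel"
  unfolding powr_def by measurable

lemma set_integrable_cpowr_times:
  assumes T: "T > 0" and W: "W \<in> borel_measurable borel"
    and bound: "\<And>t. t \<ge> T \<Longrightarrow> \<bar>W t\<bar> \<le> C * t powr (-\<alpha>)" and w: "Re w > -\<alpha>"
  shows "set_integrable lborel {T..} (\<lambda>t. complex_of_real t powr (-w - 1) * complex_of_real (W t))"
proof (rule set_integrable_bound)
  show "set_integrable lborel {T..} (\<lambda>t. C * t powr (- Re w - 1 - \<alpha>))"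
    using set_integrable_powr_to_inf[of "- Re w - 1 - \<alpha>" T] T w by simp
  show "set_borel_measurable lborel {T..} (\<lambda>t. complex_of_real t powr (-w - 1) * complex_of_real (W t))"
    unfolding set_borel_measurable_def using W by measurable
  have "norm (complex_of_real t powr (-w - 1) * complex_of_real (W t)) \<le> norm (C * t powr (- Re w - 1 - \<alpha>))"
    if t: "t \<ge> T" for t
  proof -
    have "norm (complex_of_real t powr (-w - 1) * complex_of_real (W t)) = t powr (- Re w - 1) * \<bar>W t\<bar>"
      using t T by (simp add: norm_mult norm_cpowr_of_real)
    also have "\<dots> \<le> t powr (- Re w - 1) * (C * t powr (-\<alpha>))"
      by (intro mult_left_mono bound t) auto
    also have "\<dots> = C * t powr (- Re w - 1 - \<alpha>)"
      using powr_add[of t "- Re w - 1" "-\<alpha>"] by simp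
    finally show ?thesis by simp
  qed
  thus "AE t in lborel. t \<in> {T..} \<longrightarrow> norm (complex_of_real t powr (-w - 1) * complex_of_real (W t))
          \<le> norm (C * t powr (- Re w - 1 - \<alpha>))" by auto
qed

lemma LINT_cpowr_to_inf:
  assumes T: "T > 0" and w: "Re w > 0"
  shows "(LINT t:{T..}|lborel. complex_of_real t powr (-w - 1)) = complex_of_real T powr (-w) / w"
proof -
  let ?F = "\<lambda>t. - (complex_of_real t powr (-w) / w)"
  have w0: "w \<noteq> 0" using w by auto
  have int: "set_integrable lborel {T..} (\<lambda>t. complex_of_real t powr (-w - 1))"
    using set_integrable_cpowr_times[of T "\<lambda>_. 1" 1 0 w] assms by simp
  have deriv: "(?F has_vector_derivative complex_of_real t powr (-w - 1)) (at t)" if "t > 0" for t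
  proof -
    have "((\<lambda>z. - (z powr (-w) / w)) has_field_derivative complex_of_real t powr (-w - 1)) (at (complex_of_real t))"
      using that w0 by (auto intro!: derivative_eq_intros simp: complex_nonpos_Reals_iff powr_diff)
    from has_vector_derivative_real_field[OF this] show ?thesis .
  qed
  have "(LBINT t=ereal T..\<infinity>. complex_of_real t powr (-w - 1)) = 0 - ?F T"
  proof (rule interval_integral_FTC_integrable[where F = ?F])
    show "set_integrable lborel (einterval (ereal T) \<infinity>) (\<lambda>t. complex_of_real t powr (-w - 1))"
      by (rule set_integrable_subset[OF int]) (auto simp: einterval_def)
    show "((?F \<circ> real_of_ereal) \<longlongrightarrow> ?F T) (at_right (ereal T))"
      unfolding ereal_tendsto_simps using deriv[OF T]
      by (auto dest!: has_vector_derivative_continuous simp: continuous_within intro: tendsto_mono[OF at_le])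
    have "((\<lambda>t. t powr (- Re w) / norm w) \<longlongrightarrow> 0) at_top"
      using w by (intro tendsto_divide_zero tendsto_neg_powr) (auto simp: filterlim_ident)
    moreover have "\<forall>\<^sub>F t in at_top. norm (?F t) = t powr (- Re w) / norm w"
      using eventually_gt_at_top[of 0] by eventually_elim (simp add: norm_divide norm_cpowr_of_real)
    ultimately show "((?F \<circ> real_of_ereal) \<longlongrightarrow> 0) (at_left \<infinity>)"
      unfolding ereal_tendsto_simps by (subst tendsto_norm_zero_iff[symmetric]) (simp add: tendsto_cong)
    show "isCont (\<lambda>t. complex_of_real t powr (-w - 1)) t" if "ereal T < ereal t" for t
      using that T by (intro continuous_intros) (auto simp: complex_nonpos_Reals_iff)
  qed (use T deriv in auto)
  also have "(LBINT t=ereal T..\<infinity>. complex_of_real t powr (-w - 1)) =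
       (LINT t:{T<..}|lborel. complex_of_real t powr (-w - 1))"
    by (simp add: interval_integral_to_infinity_eq)
  also have "\<dots> = (LINT t:{T..}|lborel. complex_of_real t powr (-w - 1))"
    unfolding set_lebesgue_integral_def
    by (rule integral_cong_AE)
       (use AE_lborel_singleton[of T] in \<open>auto elim!: eventually_mono split: split_indicator\<close>)
  finally show ?thesis by simp
qed

text \<open>
  Near a given \<open>w\<^sub>0\<close> the real part of \<open>w\<close> lies strictly between \<open>Re w\<^sub>0 - r\<close> and \<open>Re w\<^sub>0 + r\<close>.  The
  power of \<open>t\<close> is largest at the left end if \<open>t \<ge> 1\<close> and at the right end if \<open>t < 1\<close>, so the sum of
  the two extreme powers dominates even when the ray starts below \<open>1\<close>.
\<close>
lemma holomorphic_on_LINT_cpowr_times: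
  assumes T: "T > 0" and W: "W \<in> borel_measurable borel"
    and bound: "\<And>t. t \<ge> T \<Longrightarrow> \<bar>W t\<bar> \<le> C * t powr (-\<alpha>)"
  shows "(\<lambda>w. LINT t:{T..}|lborel. complex_of_real t powr (-w - 1) * complex_of_real (W t))
           holomorphic_on {w. Re w > -\<alpha>}"
  unfolding set_lebesgue_integral_def
proof (rule holomorphic_on_lebesgue_integral)
  show "open {w. Re w > -\<alpha>}" by (rule open_halfspace_Re_gt)
  show "(\<lambda>w. indicat_real {T..} t *\<^sub>R (complex_of_real t powr (-w - 1) * complex_of_real (W t)))
          holomorphic_on {w. Re w > -\<alpha>}" for t
  proof (cases "t \<ge> T")
    case True
    thus ?thesis using T by (auto simp: powr_def intro!: holomorphic_intros)
  qed auto
  show "(\<lambda>t. indicat_real {T..} t *\<^sub>R (complex_of_real t powr (-w - 1) * complex_of_real (W t)))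
          \<in> borel_measurable lborel" for w
    using W by measurable
  fix w\<^sub>0 assume "w\<^sub>0 \<in> {w. Re w > -\<alpha>}"
  define r where "r = (Re w\<^sub>0 + \<alpha>) / 2"
  define e where "e = - (Re w\<^sub>0 - r) - 1 - \<alpha>"
  define e' where "e' = - (Re w\<^sub>0 + r) - 1 - \<alpha>"
  have r: "r > 0" "Re w\<^sub>0 - r > -\<alpha>"
    using \<open>w\<^sub>0 \<in> _\<close> by (auto simp: r_def field_simps)
  have near: "Re w\<^sub>0 - r < Re w" "Re w < Re w\<^sub>0 + r" if "w \<in> ball w\<^sub>0 r" for w
    using that abs_Re_le_cmod[of "w\<^sub>0 - w"] by (auto simp: dist_norm)
  have "C * T powr (-\<alpha>) \<ge> 0" using bound[of T] by simp
  hence "C \<ge> 0" using T by (simp add: zero_le_mult_iff)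
  let ?g = "\<lambda>t. indicat_real {T..} t *\<^sub>R (C * t powr e + C * t powr e')"
  show "\<exists>r>0. \<exists>g. ball w\<^sub>0 r \<subseteq> {w. Re w > -\<alpha>} \<and> integrable lborel g \<and>
          (\<forall>w\<in>ball w\<^sub>0 r. \<forall>t\<in>space lborel.
             norm (indicat_real {T..} t *\<^sub>R (complex_of_real t powr (-w - 1) * complex_of_real (W t))) \<le> g t)"
  proof (intro exI[of _ r] exI[of _ ?g] conjI ballI)
    show "ball w\<^sub>0 r \<subseteq> {w. Re w > -\<alpha>}" using near r by force
    have "set_integrable lborel {T..} (\<lambda>t. C * t powr e + C * t powr e')"
      using r T by (intro set_integral_add set_integrable_mult_right set_integrable_powr_to_inf)
        (auto simp: e_def e'_def)
    thus "integrable lborel ?g" by (simp add: set_integrable_def)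
    fix w t assume w: "w \<in> ball w\<^sub>0 r"
    show "norm (indicat_real {T..} t *\<^sub>R (complex_of_real t powr (-w - 1) * complex_of_real (W t))) \<le> ?g t"
    proof (cases "t \<ge> T")
      case True
      hence t: "t > 0" using T by simp
      have "norm (complex_of_real t powr (-w - 1) * complex_of_real (W t)) = t powr (- Re w - 1) * \<bar>W t\<bar>"
        using t by (simp add: norm_mult norm_cpowr_of_real)
      also have "\<dots> \<le> t powr (- Re w - 1) * (C * t powr (-\<alpha>))"
        by (intro mult_left_mono bound True) auto
      also have "\<dots> = C * t powr (- Re w - 1 - \<alpha>)"
        using powr_add[of t "- Re w - 1" "-\<alpha>"] by simp
      also have "t powr (- Re w - 1 - \<alpha>) \<le> t powr e + t powr e'"
      proof (cases "t \<ge> 1")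
        case True
        hence "t powr (- Re w - 1 - \<alpha>) \<le> t powr e"
          using near[OF w] by (intro powr_mono) (auto simp: e_def)
        thus ?thesis by (simp add: add_increasing2)
      next
        case False
        hence "t powr (- Re w - 1 - \<alpha>) \<le> t powr e'"
          using near[OF w] t by (intro powr_mono') (auto simp: e'_def)
        thus ?thesis by (simp add: add_increasing)
      qed
      finally show ?thesis using True \<open>C \<ge> 0\<close> by (simp add: mult_left_mono distrib_left)
    qed auto
  qed (use r in auto)
qed

lemma not_set_integrable_inverse_to_inf:
  fixes T :: real
  assumes "T > 0"
  shows "\<not> set_integrable lborel {T..} inverse"
proof
  assume "set_integrable lborel {T..} (inverse :: real \<Rightarrow> real)"
  hence int: "(inverse :: real \<Rightarrow> real) integrable_on {T..}"
    by (rule set_borel_integral_eq_integral)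
  define I where "I = integral {T..} (inverse :: real \<Rightarrow> real)"
  \<comment> \<open>The integral of \<open>1 / t\<close> from \<open>T\<close> to \<open>b\<close> is \<open>ln (b / T)\<close>, made to exceed the supposed total \<open>I\<close>.\<close>
  define b where "b = T * exp (\<bar>I\<bar> + 1)"
  have "1 * T \<le> exp (\<bar>I\<bar> + 1) * T"
    using assms by (intro mult_right_mono) auto
  hence "T \<le> b" by (simp add: b_def mult.commute)
  have "(inverse has_integral (ln b - ln T)) {T..b}"
    using assms \<open>T \<le> b\<close> by (intro fundamental_theorem_of_calculus)
      (auto intro!: derivative_eq_intros simp: divide_inverse simp flip: has_real_derivative_iff_has_vector_derivative)
  moreover have "ln b - ln T = \<bar>I\<bar> + 1"
    using assms by (simp add: b_def ln_mult)
  ultimately have "(inverse has_integral (\<bar>I\<bar> + 1)) {T..b}" by simp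
  hence "\<bar>I\<bar> + 1 \<le> I"
    unfolding I_def using int assms
    by (intro has_integral_subset_le[OF _ _ integrable_integral[OF int]]) auto
  thus False by simp
qed

lemma powr_bound_on_ray:
  fixes W :: "real \<Rightarrow> real"
  assumes W: "W \<in> O[at_top](\<lambda>t. t powr (-\<alpha>))" and "\<alpha> > 0" "T > 0"
    and local_bound: "\<And>b. \<exists>B. \<forall>t\<in>{T..b}. \<bar>W t\<bar> \<le> B"
  shows "\<exists>C. \<forall>t\<ge>T. \<bar>W t\<bar> \<le> C * t powr (-\<alpha>)"
proof -
  obtain c where "c > 0" and "\<forall>\<^sub>F t in at_top. \<bar>W t\<bar> \<le> c * t powr (-\<alpha>)"
    using landau_o.bigE[OF W] by auto
  then obtain b where b: "\<And>t. t \<ge> b \<Longrightarrow> \<bar>W t\<bar> \<le> c * t powr (-\<alpha>)"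
    by (auto simp: eventually_at_top_linorder)
  obtain B where B: "\<And>t. t \<in> {T..b} \<Longrightarrow> \<bar>W t\<bar> \<le> B"
    using local_bound by blast
  have "\<bar>W t\<bar> \<le> (c + \<bar>B\<bar> * b powr \<alpha>) * t powr (-\<alpha>)" if "t \<ge> T" for t
  proof (cases "t \<ge> b")
    case True
    thus ?thesis using b[OF True] by (simp add: distrib_right add_increasing2)
  next
    case False
    \<comment> \<open>Up to \<open>b\<close> the factor \<open>b powr \<alpha>\<close> turns a constant bound into one that decays like \<open>t powr (-\<alpha>)\<close>.\<close>
    have "1 = t powr \<alpha> * t powr (-\<alpha>)"
      using that \<open>T > 0\<close> by (simp flip: powr_add)
    also have "\<dots> \<le> b powr \<alpha> * t powr (-\<alpha>)"
      using that False \<open>T > 0\<close> \<open>\<alpha> > 0\<close> by (intro mult_right_mono powr_mono2) auto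
    finally have "\<bar>B\<bar> * 1 \<le> \<bar>B\<bar> * (b powr \<alpha> * t powr (-\<alpha>))"
      by (intro mult_left_mono) auto
    moreover have "\<bar>W t\<bar> \<le> \<bar>B\<bar>" using B[of t] that False by auto
    moreover have "0 \<le> c * t powr (-\<alpha>)" using \<open>c > 0\<close> by simp
    ultimately show ?thesis by (simp add: distrib_right mult.assoc)
  qed
  thus ?thesis by blast
qed

section \<open>Minkowski contents at infinity under a power law\<close>

lemma outer_part_lmeasurable:
  "\<Omega> \<in> lmeasurable \<Longrightarrow> outer_part t \<Omega> \<in> lmeasurable"
  unfolding outer_part_def by (subst Int_commute) (intro fmeasurable_Int_fmeasurable, auto)

lemma antimono_measure_outer_part:
  assumes "\<Omega> \<in> lmeasurable"
  shows "antimono (\<lambda>t. measure lebesgue (outer_part t \<Omega>))"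
  using assms
  by (intro antimonoI measure_mono_fmeasurable outer_part_lmeasurable fmeasurableD)
     (auto simp: outer_part_def)

lemma borel_measurable_measure_outer_part:
  assumes "\<Omega> \<in> lmeasurable"
  shows "(\<lambda>t. measure lebesgue (outer_part t \<Omega>)) \<in> borel_measurable borel"
proof -
  have "mono (\<lambda>t. - measure lebesgue (outer_part t \<Omega>))"
    using antimono_measure_outer_part[OF assms] by (auto simp: mono_def antimono_def)
  from borel_measurable_uminus[OF borel_measurable_mono[OF this]] show ?thesis by simp
qed

lemma content_inf_of_power_law:
  fixes \<Omega> :: "(real ^ 'n) set"
  assumes \<Omega>: "\<Omega> \<in> lmeasurable" and "M > 0"
    and lim: "((\<lambda>t. measure lebesgue (outer_part t \<Omega>) / t powr (real CARD('n) + D)) \<longlongrightarrow> M) at_top"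
  defines "c \<equiv> \<lambda>r. if r < D then \<infinity> else if r = D then ennreal M else 0"
  shows "lower_content_inf r \<Omega> = c r" "upper_content_inf r \<Omega> = c r"
proof -
  define v where "v t = measure lebesgue (outer_part t \<Omega>) / t powr (real CARD('n) + D)" for t
  have eq: "\<forall>\<^sub>F t in at_top. emeasure lebesgue (outer_part t \<Omega>) / ennreal (t powr (real CARD('n) + r)) =
              ennreal (v t * t powr (D - r))"
    using eventually_gt_at_top[of 0]
  proof eventually_elim
    case (elim t)
    have "t powr (real CARD('n) + D) = t powr (real CARD('n) + r) * t powr (D - r)"
      by (simp flip: powr_add)
    thus ?case using elim outer_part_lmeasurable[OF \<Omega>, of t]
      by (simp add: emeasure_eq_measure2 divide_ennreal v_def)
  qed
  have "((\<lambda>t. ennreal (v t * t powr (D - r))) \<longlongrightarrow> c r) at_top"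
  proof -
    have v: "(v \<longlongrightarrow> M) at_top" using lim by (simp add: v_def[abs_def])
    consider "r < D" | "r = D" | "r > D" by linarith
    thus ?thesis
    proof cases
      case 1
      have "filterlim (\<lambda>t. v t * t powr (D - r)) at_top at_top"
        using 1 by (intro filterlim_tendsto_pos_mult_at_top[OF v \<open>M > 0\<close>]) real_asymp
      thus ?thesis using 1 by (simp add: c_def ennreal_tendsto_top_eq_at_top)
    next
      case 2
      have "((\<lambda>t. v t * t powr (D - r)) \<longlongrightarrow> M) at_top"
      proof (rule Lim_transform_eventually[OF v])
        show "\<forall>\<^sub>F t in at_top. v t = v t * t powr (D - r)"
          using eventually_gt_at_top[of 0] by eventually_elim (simp add: 2)
      qed
      thus ?thesis using 2 by (simp add: c_def tendsto_ennrealI)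
    next
      case 3
      have "((\<lambda>t::real. t powr (D - r)) \<longlongrightarrow> 0) at_top"
        using 3 by (intro tendsto_neg_powr filterlim_ident) auto
      from tendsto_mult[OF v this] have "((\<lambda>t. v t * t powr (D - r)) \<longlongrightarrow> 0) at_top" by simp
      thus ?thesis using 3 tendsto_ennrealI by (fastforce simp: c_def)
    qed
  qed
  hence L: "((\<lambda>t. emeasure lebesgue (outer_part t \<Omega>) / ennreal (t powr (real CARD('n) + r))) \<longlongrightarrow> c r) at_top"
    using tendsto_cong[OF eq] by simp
  show "lower_content_inf r \<Omega> = c r" "upper_content_inf r \<Omega> = c r"
    unfolding lower_content_inf_def upper_content_inf_def
    using lim_imp_Liminf[OF _ L] lim_imp_Limsup[OF _ L] by auto
qed

lemma Inf_ereal_image_greaterThan: "Inf (ereal ` {D<..}) = ereal D"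
proof (rule Inf_eqI)
  fix y assume y: "\<And>x. x \<in> ereal ` {D<..} \<Longrightarrow> y \<le> x"
  show "y \<le> ereal D"
  proof (rule ccontr)
    assume "\<not> y \<le> ereal D"
    then obtain r where "ereal D < ereal r" "ereal r < y"
      using ereal_dense2[of "ereal D" y] by (auto simp: not_le)
    with y[of "ereal r"] show False by auto
  qed
qed auto

section \<open>The tube zeta function under a power law\<close>

text \<open>
  The first term of the formula has the pole; the second, \<open>G (s - D)\<close>, makes sense for
  \<open>Re s > D - \<alpha>\<close>.  Since \<open>\<alpha> > 0\<close>, that half-plane contains \<open>s = D\<close>, and there the remainder can be
  subtracted from a supposedly integrable integrand, leaving the non-integrable \<open>M / t\<close>.
\<close>
lemma tube_zeta_of_power_law:
  fixes \<Omega> :: "(real ^ 'n) set"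
  assumes W: "W \<in> borel_measurable borel" and "T > 0" "\<alpha> > 0"
    and bound: "\<And>t. t \<ge> T \<Longrightarrow> \<bar>W t\<bar> \<le> C * t powr (-\<alpha>)"
    and V: "\<And>t. t \<ge> T \<Longrightarrow> measure lebesgue (outer_part t \<Omega>) = t powr (real CARD('n) + D) * (M + W t)"
  defines "G \<equiv> \<lambda>w. LINT t:{T..}|lborel. complex_of_real t powr (-w - 1) * complex_of_real (W t)"
  shows "Re s > D \<Longrightarrow> set_integrable lborel {T..} (tube_zeta_integrand \<Omega> s)"
    and "Re s > D \<Longrightarrow> tube_zeta_inf T \<Omega> s =
           complex_of_real M * complex_of_real T powr (-(s - D)) / (s - D) + G (s - D)"
    and "M \<noteq> 0 \<Longrightarrow> \<not> set_integrable lborel {T..} (tube_zeta_integrand \<Omega> (complex_of_real D))"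
proof -
  let ?main = "\<lambda>(s::complex) t. complex_of_real M * complex_of_real t powr (-(s - D) - 1)"
  let ?rem = "\<lambda>(s::complex) t. complex_of_real t powr (-(s - D) - 1) * complex_of_real (W t)"
  have split: "tube_zeta_integrand \<Omega> s t = ?main s t + ?rem s t" if "t \<ge> T" for s :: complex and t
  proof -
    have t: "t > 0" using that \<open>T > 0\<close> by simp
    let ?e = "-s - of_nat CARD('n) - 1"
    have "complex_of_real t powr ?e * complex_of_real (t powr (real CARD('n) + D)) =
            complex_of_real t powr ?e * complex_of_real t powr complex_of_real (real CARD('n) + D)"
      using t by (simp only: powr_of_real less_imp_le)
    also have "\<dots> = complex_of_real t powr (?e + complex_of_real (real CARD('n) + D))"
      by (simp only: powr_add)
    also have "?e + complex_of_real (real CARD('n) + D) = -(s - D) - 1" by simp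
    finally have "complex_of_real t powr ?e * complex_of_real (t powr (real CARD('n) + D)) =
                    complex_of_real t powr (-(s - D) - 1)" .
    thus ?thesis unfolding tube_zeta_integrand_def V[OF that]
      by (simp add: algebra_simps)
  qed
  have rem: "set_integrable lborel {T..} (?rem s)" if "Re s > D - \<alpha>" for s
    using that by (intro set_integrable_cpowr_times[OF \<open>T > 0\<close> W bound]) auto
  have main: "set_integrable lborel {T..} (?main s)" if "Re s > D" for s
    using that set_integrable_cpowr_times[of T "\<lambda>_. 1" 1 0 "s - D"] \<open>T > 0\<close> by simp
  have cong: "set_integrable lborel {T..} (tube_zeta_integrand \<Omega> s) \<longleftrightarrow>
              set_integrable lborel {T..} (\<lambda>t. ?main s t + ?rem s t)" for s :: complex
    using split by (intro set_integrable_cong) auto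
  show "set_integrable lborel {T..} (tube_zeta_integrand \<Omega> s)" if "Re s > D"
    unfolding cong using that \<open>\<alpha> > 0\<close> by (intro set_integral_add main rem) auto
  show "tube_zeta_inf T \<Omega> s = complex_of_real M * complex_of_real T powr (-(s - D)) / (s - D) + G (s - D)"
    if "Re s > D"
  proof -
    have "tube_zeta_inf T \<Omega> s = (LINT t:{T..}|lborel. ?main s t + ?rem s t)"
      unfolding tube_zeta_inf_def using split by (intro set_lebesgue_integral_cong) auto
    also have "\<dots> = (LINT t:{T..}|lborel. ?main s t) + G (s - D)"
      unfolding G_def using that \<open>\<alpha> > 0\<close> by (intro set_integral_add main rem) auto
    also have "(LINT t:{T..}|lborel. ?main s t) = complex_of_real M * complex_of_real T powr (-(s - D)) / (s - D)"
      using LINT_cpowr_to_inf[OF \<open>T > 0\<close>, of "s - D"] that by simp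
    finally show ?thesis .
  qed
  show "\<not> set_integrable lborel {T..} (tube_zeta_integrand \<Omega> (complex_of_real D))" if "M \<noteq> 0"
  proof
    assume "set_integrable lborel {T..} (tube_zeta_integrand \<Omega> (complex_of_real D))"
    hence "set_integrable lborel {T..} (\<lambda>t. ?main D t + ?rem D t)" by (simp only: cong)
    from set_integral_diff(1)[OF this rem[of D]] have "set_integrable lborel {T..} (?main D)"
      using \<open>\<alpha> > 0\<close> by simp
    hence "set_integrable lborel {T..} (\<lambda>t. norm (?main D t / complex_of_real M))"
      by (intro set_integrable_norm set_integrable_divide) auto
    also have "?this \<longleftrightarrow> set_integrable lborel {T..} (inverse :: real \<Rightarrow> real)"
      using that \<open>T > 0\<close>
      by (intro set_integrable_cong) (auto simp: norm_cpowr_of_real powr_minus norm_inverse)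
    finally show False
      using not_set_integrable_inverse_to_inf[OF \<open>T > 0\<close>] by contradiction
  qed
qed

theorem theorem3p4:
  fixes \<Omega> :: "(real ^ 'n) set" and \<alpha> M D T :: real
  assumes "\<Omega> \<in> sets lebesgue" and "emeasure lebesgue \<Omega> < \<infinity>"
    and "\<alpha> > 0" and "M > 0" and "D < - real CARD('n)"
    and "\<exists>R. R \<in> O[at_top](\<lambda>t::real. t powr (- \<alpha>)) \<and>
           (\<forall>\<^sub>F t in at_top. measure lebesgue (outer_part t \<Omega>) =
              t powr (real CARD('n) + D) * (M + R t))"
    and "T > 0"
  shows "dim_inf_exists \<Omega> \<and> dim_inf \<Omega> = ereal D \<and>
    minkowski_measurable_inf \<Omega> \<and>
    lower_content_inf D \<Omega> = upper_content_inf D \<Omega> \<and> content_inf D \<Omega> = ennreal M \<and>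
    tube_zeta_abscissa T \<Omega> = dim_inf \<Omega> \<and> tube_zeta_abscissa T \<Omega> = ereal D \<and>
    (\<exists>Z. tube_zeta_continuation T \<Omega> {s. Re s > D - \<alpha>} Z \<and>
       (\<forall>Z'. tube_zeta_continuation T \<Omega> {s. Re s > D - \<alpha>} Z' \<longrightarrow>
          (\<forall>s. Re s > D - \<alpha> \<longrightarrow> Z' s = Z s)) \<and>
       (\<forall>s. Re s > D - \<alpha> \<longrightarrow> (is_pole Z s \<longleftrightarrow> s = complex_of_real D)) \<and>
       zorder Z (complex_of_real D) = - 1 \<and>
       residue Z (complex_of_real D) = complex_of_real M)"
proof -
  have \<Omega>: "\<Omega> \<in> lmeasurable" using assms(1,2) by (auto intro: fmeasurableI)
  define V where "V t = measure lebesgue (outer_part t \<Omega>)" for t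
  define W where "W t = V t / t powr (real CARD('n) + D) - M" for t
  obtain R where R: "R \<in> O[at_top](\<lambda>t::real. t powr (- \<alpha>))"
    "\<forall>\<^sub>F t in at_top. V t = t powr (real CARD('n) + D) * (M + R t)"
    using assms(6) unfolding V_def by blast
  have "\<forall>\<^sub>F t in at_top. R t = W t"
    using R(2) eventually_gt_at_top[of 0] by eventually_elim (simp add: W_def)
  hence WO: "W \<in> O[at_top](\<lambda>t::real. t powr (- \<alpha>))"
    using R(1) landau_o.big.in_cong by blast
  have V0: "V t \<ge> 0" for t by (simp add: V_def)
  have Vanti: "antimono V"
    using antimono_measure_outer_part[OF \<Omega>] by (simp add: V_def[abs_def])
  have Wmeas: "W \<in> borel_measurable borel"
    using borel_measurable_measure_outer_part[OF \<Omega>] unfolding W_def[abs_def] V_def by measurable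
  have VW: "V t = t powr (real CARD('n) + D) * (M + W t)" if "t \<ge> T" for t
    using that \<open>T > 0\<close> by (simp add: W_def)
  have "\<exists>C. \<forall>t\<ge>T. \<bar>W t\<bar> \<le> C * t powr (-\<alpha>)"
  proof (rule powr_bound_on_ray[OF WO \<open>\<alpha> > 0\<close> \<open>T > 0\<close>])
    fix b
    \<comment> \<open>Here \<open>D < - N\<close> enters: \<open>t powr (- (N + D))\<close> increases, so it is largest at \<open>b\<close>.\<close>
    have "\<bar>W t\<bar> \<le> V T * b powr (- (real CARD('n) + D)) + M" if "t \<in> {T..b}" for t
    proof -
      have "\<bar>W t\<bar> \<le> V t * t powr (- (real CARD('n) + D)) + M"
        using divide_nonneg_nonneg[OF V0[of t] powr_ge_zero[of t "real CARD('n) + D"]] \<open>M > 0\<close>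
        unfolding W_def powr_minus divide_inverse[symmetric] by linarith
      also have "V t * t powr (- (real CARD('n) + D)) \<le> V T * b powr (- (real CARD('n) + D))"
        using that assms(5) \<open>T > 0\<close> V0 antimonoD[OF Vanti, of T t]
        by (intro mult_mono powr_mono2) auto
      finally show ?thesis by simp
    qed
    thus "\<exists>B. \<forall>t\<in>{T..b}. \<bar>W t\<bar> \<le> B" by blast
  qed
  then obtain C where C: "\<And>t. t \<ge> T \<Longrightarrow> \<bar>W t\<bar> \<le> C * t powr (-\<alpha>)" by blast

  have "((\<lambda>t::real. C * t powr (-\<alpha>)) \<longlongrightarrow> 0) at_top"
    using \<open>\<alpha> > 0\<close> by (intro tendsto_mult_right_zero tendsto_neg_powr filterlim_ident) auto
  moreover have "\<forall>\<^sub>F t in at_top. norm (W t) \<le> C * t powr (-\<alpha>)"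
    using eventually_ge_at_top[of T] by eventually_elim (simp add: C)
  ultimately have "(W \<longlongrightarrow> 0) at_top" by (rule Lim_null_comparison[rotated])
  hence "((\<lambda>t. W t + M) \<longlongrightarrow> 0 + M) at_top" by (intro tendsto_add tendsto_const)
  hence lim: "((\<lambda>t. measure lebesgue (outer_part t \<Omega>) / t powr (real CARD('n) + D)) \<longlongrightarrow> M) at_top"
    by (simp add: W_def V_def)
  note cont = content_inf_of_power_law[OF \<Omega> \<open>M > 0\<close> lim]
  have "{r. (if r < D then \<infinity> else if r = D then ennreal M else 0) = 0} = {D<..}"
    using \<open>M > 0\<close> by (auto simp: not_less)
  hence dims: "lower_dim_inf \<Omega> = ereal D" "upper_dim_inf \<Omega> = ereal D"
    unfolding lower_dim_inf_def upper_dim_inf_def cont by (simp_all add: Inf_ereal_image_greaterThan)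
  have dim: "dim_inf_exists \<Omega>" "dim_inf \<Omega> = ereal D"
    by (simp_all add: dim_inf_exists_def dim_inf_def dims)
  have minkowski: "minkowski_measurable_inf \<Omega>" "content_inf D \<Omega> = ennreal M"
    using \<open>M > 0\<close> by (auto simp: minkowski_measurable_inf_def content_inf_def dim cont)

  note zeta = tube_zeta_of_power_law[OF Wmeas \<open>T > 0\<close> \<open>\<alpha> > 0\<close> C VW[unfolded V_def]]
  have "\<sigma> \<ge> D" if "\<forall>s. Re s > \<sigma> \<longrightarrow> set_integrable lborel {T..} (tube_zeta_integrand \<Omega> s)" for \<sigma>
    using that zeta(3) \<open>M > 0\<close> by (cases "\<sigma> < D") auto
  hence "{\<sigma>. \<forall>s. Re s > \<sigma> \<longrightarrow> set_integrable lborel {T..} (tube_zeta_integrand \<Omega> s)} = {D..}"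
    using zeta(1) by auto
  hence abscissa: "tube_zeta_abscissa T \<Omega> = ereal D"
    unfolding tube_zeta_abscissa_def by (intro Inf_eqI) auto

  define A where "A = {s. Re s > D - \<alpha>}"
  define G where "G w = (LINT t:{T..}|lborel. complex_of_real t powr (-w - 1) * complex_of_real (W t))" for w :: complex
  \<comment> \<open>The continuation is \<open>H s / (s - D)\<close>; for \<open>s \<noteq> D\<close> this is the sum of the explicit pole term and \<open>G (s - D)\<close>.\<close>
  define H where "H s = complex_of_real M * complex_of_real T powr (-(s - D)) + (s - D) * G (s - D)" for s :: complex
  define Z where "Z = (\<lambda>s. H s / (s - complex_of_real D))"
  have A: "open A" "connected A" "complex_of_real D \<in> A"
    using \<open>\<alpha> > 0\<close> by (auto simp: A_def open_halfspace_Re_gt convex_halfspace_Re_gt convex_connected)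
  have "G holomorphic_on {w. Re w > -\<alpha>}"
    unfolding G_def[abs_def] by (rule holomorphic_on_LINT_cpowr_times[OF \<open>T > 0\<close> Wmeas C])
  hence "(G \<circ> (\<lambda>s. s - D)) holomorphic_on A"
    by (intro holomorphic_on_compose_gen[where t = "{w. Re w > -\<alpha>}"] holomorphic_intros) (auto simp: A_def)
  hence H: "H holomorphic_on A"
    using \<open>T > 0\<close> unfolding H_def[abs_def] o_def powr_def by (auto intro!: holomorphic_intros)
  have HD: "H D = M" using \<open>T > 0\<close> by (simp add: H_def)
  have "H D \<noteq> 0" using HD \<open>M > 0\<close> by simp
  note Z = simple_pole_quotient[OF A(1,3) H this, folded Z_def]
  have Zeq: "Z s = tube_zeta_inf T \<Omega> s" if "Re s > D" for s
  proof -
    have "s \<noteq> D" using that by auto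
    thus ?thesis using zeta(2)[OF _ _ that] by (simp add: Z_def H_def G_def field_simps)
  qed
  have Zcont: "tube_zeta_continuation T \<Omega> A Z"
    unfolding tube_zeta_continuation_def abscissa using Z(1) Zeq \<open>\<alpha> > 0\<close> by (auto simp: A_def)
  have unique: "Z' s = Z s" if Z': "tube_zeta_continuation T \<Omega> A Z'" and "s \<in> A" for Z' s
  proof (rule nicely_meromorphic_on_eqI[OF _ Z(1) A(1,2), where z = "D + 1"])
    show "Z' nicely_meromorphic_on A" using Z' by (simp add: tube_zeta_continuation_def)
    show "complex_of_real (D + 1) \<in> A" using \<open>\<alpha> > 0\<close> by (simp add: A_def)
    have "\<forall>\<^sub>F w in at (complex_of_real (D + 1)). w \<in> {w. Re w > D}"
      by (intro eventually_at_in_open' open_halfspace_Re_gt) auto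
    hence "\<forall>\<^sub>F w in at (complex_of_real (D + 1)). Z' w = Z w"
      by eventually_elim (use Z' Zeq abscissa in \<open>auto simp: tube_zeta_continuation_def\<close>)
    thus "\<exists>\<^sub>F w in at (complex_of_real (D + 1)). Z' w = Z w"
      by (intro eventually_frequently) auto
  qed fact
  show ?thesis
    unfolding A_def[symmetric]
    using dim minkowski abscissa cont Zcont unique Z(2-4) HD
    by (intro conjI exI[of _ Z]) (auto simp: A_def)
qed

end
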